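(* Let $f:X\to Y$ be a continuous map and let $B\subseteq X$. Then $$TC^S(f,B)\le \min\{TC(X,B),\,TC(Y,f(B))\}.$$
   Context: For a topological space $X$, $PX=X^I$ is the space of continuous paths $[0,1]\to X$ with the compact-open topology, and for $B\subseteq X$, $P_{X\times B}=\{\gamma\in PX:\gamma(1)\in B\}$. For a continuous map $f:X\to Y$ and $B\subseteq X$, $TC^S(f,B)$ is the least integer $n\ge0$ such that $X\times B$ has an open cover $U_0,\dots,U_n$ with, for each $i$, a continuous map $\sigma_i:U_i\to P_{Y\times f(B)}$ satisfying $\sigma_i(x,b)(0)=f(x)$ and $\sigma_i(x,b)(1)=f(b)$ ($\infty$ if there is none). For a space $X$ and $B\subseteq X$, the relative topological complexity $TC(X,B)$ is the least integer $n\ge0$ such that $X\times B$ has an open cover $U_0,\dots,U_n$ with, over each $U_i$, a continuous section of $\pi_B:P_{X\times B}\to X\times B$, $\pi_B(\gamma)=(\gamma(0),\gamma(1))$ ($\infty$ if there is none). *)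

theory Defs
  imports "HOL-Analysis.Analysis" "HOL-Library.Extended_Nat"
begin

text \<open>
  Spaces are abstract topologies. A path is a continuous map out of the unit interval; since HOL
  functions are total, a path is required to be extensional (\<^term>\<open>undefined\<close> outside the
  interval), so that equality of paths is equality on the interval.
\<close>

definition paths :: "'a topology \<Rightarrow> (real \<Rightarrow> 'a) set" where
  "paths X = {\<gamma> \<in> extensional {0..1}. pathin X \<gamma>}"

text \<open>
  The compact-open topology, given by its standard subbasis. The choice of the empty compact set
  shows that the subbasis covers \<^term>\<open>paths X\<close>.
\<close>

definition path_space :: "'a topology \<Rightarrow> (real \<Rightarrow> 'a) topology" where
  "path_space X = topology_generated_by
     {{\<gamma> \<in> paths X. \<gamma> ` K \<subseteq> U} |K U. compact K \<and> K \<subseteq> {0..1} \<and> openin X U}"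

lemma topspace_path_space [simp]: "topspace (path_space X) = paths X"
proof -
  have "paths X = {\<gamma> \<in> paths X. \<gamma> ` {} \<subseteq> {}}"
    by simp
  then show ?thesis
    unfolding path_space_def topology_generated_by_topspace by blast
qed

definition path_space_to :: "'a topology \<Rightarrow> 'a set \<Rightarrow> (real \<Rightarrow> 'a) topology" where
  "path_space_to X B = subtopology (path_space X) {\<gamma>. \<gamma> 1 \<in> B}"

definition endpoints :: "(real \<Rightarrow> 'a) \<Rightarrow> 'a \<times> 'a" where
  "endpoints \<gamma> = (\<gamma> 0, \<gamma> 1)"

abbreviation rel_square :: "'a topology \<Rightarrow> 'a set \<Rightarrow> ('a \<times> 'a) topology" where
  "rel_square X B \<equiv> prod_topology X (subtopology X B)"

text \<open>An open cover \<open>U 0, \<dots>, U n\<close> consisting of \<open>n + 1\<close> (possibly empty) sets.\<close>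

definition open_cover_upto :: "'a topology \<Rightarrow> nat \<Rightarrow> (nat \<Rightarrow> 'a set) \<Rightarrow> bool" where
  "open_cover_upto X n U \<longleftrightarrow> (\<forall>i\<le>n. openin X (U i)) \<and> (\<Union>i\<le>n. U i) = topspace X"

text \<open>
  Both invariants take values in \<^typ>\<open>enat\<close>: the infimum is the least element of a nonempty set
  and \<open>\<infinity>\<close> for the empty set.
\<close>

definition rel_TC :: "'a topology \<Rightarrow> 'a set \<Rightarrow> enat" where
  "rel_TC X B = Inf (enat ` {n. \<exists>U. open_cover_upto (rel_square X B) n U \<and>
     (\<forall>i\<le>n. \<exists>s. continuous_map (subtopology (rel_square X B) (U i)) (path_space_to X B) s \<and>
        (\<forall>p\<in>U i. endpoints (s p) = p))})"

definition TCS :: "'a topology \<Rightarrow> 'b topology \<Rightarrow> ('a \<Rightarrow> 'b) \<Rightarrow> 'a set \<Rightarrow> enat" where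
  "TCS X Y f B = Inf (enat ` {n. \<exists>U. open_cover_upto (rel_square X B) n U \<and>
     (\<forall>i\<le>n. \<exists>\<sigma>. continuous_map (subtopology (rel_square X B) (U i)) (path_space_to Y (f ` B)) \<sigma> \<and>
        (\<forall>(x, b)\<in>U i. \<sigma> (x, b) 0 = f x \<and> \<sigma> (x, b) 1 = f b))})"

end

theory Submission
  imports Defs
begin

text \<open>
  Each of the two bounds comes from transporting a motion planner along \<open>f\<close>. A
  planner on \<open>X \<times> B\<close> yields one for \<open>f\<close> over the same open
  cover, by composing the planned paths with \<open>f\<close>; this is continuous because the
  induced map of path spaces is (\<open>continuous_map_path_map\<close>, used in
  \<open>TCS_le_rel_TC_source\<close>). A planner on \<open>Y \<times> f(B)\<close> yields one
  for \<open>f\<close> over the open cover pulled back along \<open>f \<times> f : X \<times> B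
  \<rightarrow> Y \<times> f(B)\<close>, by planning between the images of the given points
  (\<open>TCS_le_rel_TC_target\<close>). Neither construction changes the number of open sets,
  so every integer admissible for either relative topological complexity is admissible for the
  complexity of \<open>f\<close>.
\<close>

text \<open>The restriction to the unit interval makes the composite an extensional path.\<close>

definition path_map :: "('a \<Rightarrow> 'b) \<Rightarrow> (real \<Rightarrow> 'a) \<Rightarrow> real \<Rightarrow> 'b" where
  "path_map f \<gamma> = restrict (f \<circ> \<gamma>) {0..1}"

lemma path_map_in_paths:
  assumes "continuous_map X Y f" and "\<gamma> \<in> paths X"
  shows "path_map f \<gamma> \<in> paths Y"
proof -
  have "pathin Y (f \<circ> \<gamma>)"
    using assms by (auto simp: paths_def pathin_def intro: continuous_map_compose)
  then have "pathin Y (path_map f \<gamma>)"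
    unfolding pathin_def path_map_def by (rule continuous_map_eq) auto
  then show ?thesis
    by (simp add: paths_def path_map_def)
qed

text \<open>
  On subbasic sets: \<open>f \<circ> \<gamma>\<close> sends \<open>K\<close> into \<open>U\<close> exactly when \<open>\<gamma>\<close> sends \<open>K\<close> into the
  preimage of \<open>U\<close>, which is open.
\<close>

lemma continuous_map_path_map:
  assumes f: "continuous_map X Y f"
  shows "continuous_map (path_space X) (path_space Y) (path_map f)"
proof -
  let ?\<S> = "{{\<gamma> \<in> paths Y. \<gamma> ` K \<subseteq> U} |K U. compact K \<and> K \<subseteq> {0..1} \<and> openin Y U}"
  have "openin (path_space X) (path_map f -` W \<inter> topspace (path_space X))" if W_in: "W \<in> ?\<S>" for W
  proof -
    obtain K U where W: "W = {\<gamma> \<in> paths Y. \<gamma> ` K \<subseteq> U}"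
      and K: "compact K" "K \<subseteq> {0..1}" and U: "openin Y U"
      using W_in by blast
    let ?V = "{x \<in> topspace X. f x \<in> U}"
    have V: "openin X ?V"
      using f U by (rule openin_continuous_map_preimage)
    have "path_map f \<gamma> ` K \<subseteq> U \<longleftrightarrow> \<gamma> ` K \<subseteq> ?V" if "\<gamma> \<in> paths X" for \<gamma>
    proof -
      have "\<gamma> t \<in> topspace X" if "t \<in> K" for t
        using \<open>\<gamma> \<in> paths X\<close> that K(2)
        by (auto simp: paths_def pathin_def continuous_map_def)
      moreover have "path_map f \<gamma> t = f (\<gamma> t)" if "t \<in> K" for t
        using that K(2) by (auto simp: path_map_def)
      ultimately show ?thesis
        by (auto simp: image_subset_iff)
    qed
    then have "path_map f -` W \<inter> topspace (path_space X) = {\<gamma> \<in> paths X. \<gamma> ` K \<subseteq> ?V}"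
      using path_map_in_paths[OF f] by (auto simp: W)
    also have "openin (path_space X) \<dots>"
      unfolding path_space_def using K V by (intro topology_generated_by_Basis) blast
    finally show ?thesis .
  qed
  moreover have "path_map f ` topspace (path_space X) \<subseteq> \<Union> ?\<S>"
  proof -
    have "path_map f ` topspace (path_space X) \<subseteq> topspace (path_space Y)"
      using path_map_in_paths[OF f] by auto
    then show ?thesis
      unfolding path_space_def topology_generated_by_topspace .
  qed
  ultimately show ?thesis
    unfolding path_space_def[of Y] continuous_on_generated_topo_iff by blast
qed

lemma continuous_map_path_map_to:
  assumes "continuous_map X Y f"
  shows "continuous_map (path_space_to X B) (path_space_to Y (f ` B)) (path_map f)"
  unfolding path_space_to_def
  by (rule continuous_map_into_subtopology)
    (auto simp: path_map_def
      intro: continuous_map_from_subtopology continuous_map_path_map[OF assms])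

lemma TCS_le_rel_TC_source:
  assumes f: "continuous_map X Y f"
  shows "TCS X Y f B \<le> rel_TC X B"
  unfolding TCS_def rel_TC_def
proof (intro Inf_superset_mono image_mono subsetI CollectI; elim CollectE exE conjE)
  fix n U
  assume cover: "open_cover_upto (rel_square X B) n U"
    and sections: "\<forall>i\<le>n. \<exists>s. continuous_map (subtopology (rel_square X B) (U i)) (path_space_to X B) s
      \<and> (\<forall>p\<in>U i. endpoints (s p) = p)"
  have "\<exists>\<sigma>. continuous_map (subtopology (rel_square X B) (U i)) (path_space_to Y (f ` B)) \<sigma>
      \<and> (\<forall>(x, b)\<in>U i. \<sigma> (x, b) 0 = f x \<and> \<sigma> (x, b) 1 = f b)" if i: "i \<le> n" for i
  proof -
    obtain s where s: "continuous_map (subtopology (rel_square X B) (U i)) (path_space_to X B) s"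
      and ends: "\<forall>p\<in>U i. endpoints (s p) = p"
      using sections i by blast
    have "continuous_map (subtopology (rel_square X B) (U i)) (path_space_to Y (f ` B))
        (path_map f \<circ> s)"
      using s continuous_map_path_map_to[OF f] by (rule continuous_map_compose)
    moreover have "\<forall>(x, b)\<in>U i. (path_map f \<circ> s) (x, b) 0 = f x \<and> (path_map f \<circ> s) (x, b) 1 = f b"
    proof clarify
      fix x b
      assume "(x, b) \<in> U i"
      with ends have "endpoints (s (x, b)) = (x, b)" by blast
      then show "(path_map f \<circ> s) (x, b) 0 = f x \<and> (path_map f \<circ> s) (x, b) 1 = f b"
        by (simp add: path_map_def endpoints_def)
    qed
    ultimately show ?thesis by blast
  qed
  with cover show "\<exists>U. open_cover_upto (rel_square X B) n U \<and>
     (\<forall>i\<le>n. \<exists>\<sigma>. continuous_map (subtopology (rel_square X B) (U i)) (path_space_to Y (f ` B)) \<sigma> \<and>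
        (\<forall>(x, b)\<in>U i. \<sigma> (x, b) 0 = f x \<and> \<sigma> (x, b) 1 = f b))"
    by blast
qed

lemma continuous_map_rel_square:
  assumes f: "continuous_map X Y f"
  shows "continuous_map (rel_square X B) (rel_square Y (f ` B)) (map_prod f f)"
proof -
  have "continuous_map (subtopology X B) (subtopology Y (f ` B)) f"
    using f by (auto intro: continuous_map_into_subtopology continuous_map_from_subtopology)
  with f show ?thesis
    by (simp add: map_prod_def continuous_map_prod_top)
qed

lemma open_cover_upto_preimage:
  assumes g: "continuous_map X Y g" and "open_cover_upto Y n U"
  shows "open_cover_upto X n (\<lambda>i. {x \<in> topspace X. g x \<in> U i})"
proof -
  have "g x \<in> (\<Union>i\<le>n. U i)" if "x \<in> topspace X" for x
    using assms that by (auto simp: open_cover_upto_def continuous_map_def)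
  with assms show ?thesis
    by (auto simp: open_cover_upto_def intro: openin_continuous_map_preimage)
qed

lemma TCS_le_rel_TC_target:
  assumes f: "continuous_map X Y f"
  shows "TCS X Y f B \<le> rel_TC Y (f ` B)"
  unfolding TCS_def rel_TC_def
proof (intro Inf_superset_mono image_mono subsetI CollectI; elim CollectE exE conjE)
  fix n U
  assume cover: "open_cover_upto (rel_square Y (f ` B)) n U"
    and sections: "\<forall>i\<le>n. \<exists>s. continuous_map (subtopology (rel_square Y (f ` B)) (U i))
        (path_space_to Y (f ` B)) s \<and> (\<forall>p\<in>U i. endpoints (s p) = p)"
  let ?V = "\<lambda>i. {p \<in> topspace (rel_square X B). map_prod f f p \<in> U i}"
  note ff = continuous_map_rel_square[OF f, of B]
  have "\<exists>\<sigma>. continuous_map (subtopology (rel_square X B) (?V i)) (path_space_to Y (f ` B)) \<sigma>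
      \<and> (\<forall>(x, b)\<in>?V i. \<sigma> (x, b) 0 = f x \<and> \<sigma> (x, b) 1 = f b)" if i: "i \<le> n" for i
  proof -
    obtain s where s: "continuous_map (subtopology (rel_square Y (f ` B)) (U i))
        (path_space_to Y (f ` B)) s"
      and ends: "\<forall>p\<in>U i. endpoints (s p) = p"
      using sections i by blast
    have "continuous_map (subtopology (rel_square X B) (?V i))
        (subtopology (rel_square Y (f ` B)) (U i)) (map_prod f f)"
      by (rule continuous_map_into_subtopology[OF continuous_map_from_subtopology[OF ff]]) auto
    then have "continuous_map (subtopology (rel_square X B) (?V i)) (path_space_to Y (f ` B))
        (s \<circ> map_prod f f)"
      using s by (rule continuous_map_compose)
    moreover have "\<forall>(x, b)\<in>?V i. (s \<circ> map_prod f f) (x, b) 0 = f x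
        \<and> (s \<circ> map_prod f f) (x, b) 1 = f b"
    proof clarify
      fix x b
      assume "map_prod f f (x, b) \<in> U i"
      with ends have "endpoints (s (map_prod f f (x, b))) = map_prod f f (x, b)" by blast
      then show "(s \<circ> map_prod f f) (x, b) 0 = f x \<and> (s \<circ> map_prod f f) (x, b) 1 = f b"
        by (simp add: endpoints_def)
    qed
    ultimately show ?thesis by blast
  qed
  with open_cover_upto_preimage[OF ff cover]
  show "\<exists>U. open_cover_upto (rel_square X B) n U \<and>
     (\<forall>i\<le>n. \<exists>\<sigma>. continuous_map (subtopology (rel_square X B) (U i)) (path_space_to Y (f ` B)) \<sigma> \<and>
        (\<forall>(x, b)\<in>U i. \<sigma> (x, b) 0 = f x \<and> \<sigma> (x, b) 1 = f b))"
    by (intro exI[of _ ?V]) blast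
qed

theorem proposition5p5:
  fixes X :: "'a topology" and Y :: "'b topology" and f :: "'a \<Rightarrow> 'b" and B :: "'a set"
  assumes "continuous_map X Y f" and "B \<subseteq> topspace X"
  shows "TCS X Y f B \<le> min (rel_TC X B) (rel_TC Y (f ` B))"
  using TCS_le_rel_TC_source[OF assms(1)] TCS_le_rel_TC_target[OF assms(1)] by simp

end
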